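(* For every $\varepsilon>0$, there exists $\delta>0$ such that the following holds. If $G$ is a graph with $m\ge1$ edges and $\lambda(G)\ge(1-\delta)\sqrt m$, then either $$\operatorname{bk}(G)\ge\left(\frac13-\varepsilon\right)\sqrt m,$$ or there exist disjoint sets $A,B\subseteq V(G)$ such that $\bigl|E(G)\,\triangle\,E(K_{A,B})\bigr|\le\varepsilon m$.
   Context: Graphs are finite and simple. $\lambda(G)$ is the spectral radius of the adjacency matrix of $G$. The booksize is $\operatorname{bk}(G)=\max_{uv\in E(G)}|N(u)\cap N(v)|$, the maximum number of triangles sharing a common edge. For disjoint vertex sets $A,B$, $K_{A,B}$ is the complete bipartite graph with parts $A$ and $B$, so $E(K_{A,B})=\{ab: a\in A,\ b\in B\}$. $\triangle$ denotes symmetric difference of sets. *)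

theory Defs
  imports "Jordan_Normal_Form.Spectral_Radius"
begin

definition simple_graph :: "'a set \<Rightarrow> 'a set set \<Rightarrow> bool" where
  "simple_graph V E \<longleftrightarrow> finite V \<and> (\<forall>e\<in>E. e \<subseteq> V \<and> card e = 2)"

definition nbhd :: "'a set set \<Rightarrow> 'a \<Rightarrow> 'a set" where
  "nbhd E u = {v. {u, v} \<in> E}"

definition booksize :: "'a set set \<Rightarrow> nat" where
  "booksize E = Max {card (nbhd E u \<inter> nbhd E v) | u v. {u, v} \<in> E}"

definition bipartite_edges :: "'a set \<Rightarrow> 'a set \<Rightarrow> 'a set set" where
  "bipartite_edges A B = {{a, b} | a b. a \<in> A \<and> b \<in> B}"

text \<open>The entries are complex because the library's spectral radius is defined for complex
  matrices. Rows and columns follow the order of the vertices in the list.\<close>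

definition adjacency_mat :: "'a list \<Rightarrow> 'a set set \<Rightarrow> complex mat" where
  "adjacency_mat vs E =
     mat (length vs) (length vs) (\<lambda>(i, j). if {vs ! i, vs ! j} \<in> E then 1 else 0)"

text \<open>The enumeration of the vertices is arbitrary; by
  \<open>graph_spectral_radius_eq\<close> below, every enumeration gives the same value.\<close>

definition graph_spectral_radius :: "'a set \<Rightarrow> 'a set set \<Rightarrow> real" where
  "graph_spectral_radius V E =
     spectral_radius (adjacency_mat (SOME vs. distinct vs \<and> set vs = V) E)"

lemma eigenvalue_adjacency_mat_iff:
  assumes "distinct vs"
  shows "eigenvalue (adjacency_mat vs E) k \<longleftrightarrow>
    (\<exists>f. (\<exists>u\<in>set vs. f u \<noteq> 0) \<and>
         (\<forall>u\<in>set vs. (\<Sum>w\<in>set vs. (if {u, w} \<in> E then 1 else 0) * f w) = k * f u))"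
    (is "?L \<longleftrightarrow> ?R")
proof -
  let ?n = "length vs"
  have bij: "bij_betw ((!) vs) {0..<?n} (set vs)"
    using bij_betw_nth[OF assms, of "{0..<?n}" "set vs"] by (simp add: lessThan_atLeast0)
  have sum_eq: "(\<Sum>w\<in>set vs. h w) = (\<Sum>j\<in>{0..<?n}. h (vs ! j))" for h :: "'a \<Rightarrow> complex"
    using sum.reindex_bij_betw[OF bij, of h] by simp
  show ?thesis
  proof
    assume ?L
    then obtain v where v: "v \<in> carrier_vec ?n" "v \<noteq> 0\<^sub>v ?n"
        "adjacency_mat vs E *\<^sub>v v = k \<cdot>\<^sub>v v"
      by (auto simp: eigenvalue_def eigenvector_def adjacency_mat_def)
    define f where "f u = v $ (inv_into {0..<?n} ((!) vs) u)" for u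
    have f: "f (vs ! i) = v $ i" if "i < ?n" for i
      using that bij by (auto simp: f_def bij_betw_def inv_into_f_f)
    obtain i where i: "i < ?n" "v $ i \<noteq> 0" using v by (auto simp: vec_eq_iff)
    have "(\<Sum>w\<in>set vs. (if {u, w} \<in> E then 1 else 0) * f w) = k * f u"
      if u: "u \<in> set vs" for u
    proof -
      obtain j where j: "j < ?n" "u = vs ! j" using u by (metis in_set_conv_nth)
      have "(adjacency_mat vs E *\<^sub>v v) $ j = (k \<cdot>\<^sub>v v) $ j" using v by simp
      then show ?thesis using j v f
        by (simp add: sum_eq adjacency_mat_def scalar_prod_def)
    qed
    moreover have "\<exists>u\<in>set vs. f u \<noteq> 0" using i f nth_mem by metis
    ultimately show ?R by blast
  next
    assume ?R
    then obtain f where f: "\<exists>u\<in>set vs. f u \<noteq> 0"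
      "\<forall>u\<in>set vs. (\<Sum>w\<in>set vs. (if {u, w} \<in> E then 1 else 0) * f w) = k * f u" by blast
    define v where "v = vec ?n (\<lambda>i. f (vs ! i))"
    have "v \<noteq> 0\<^sub>v ?n" using f(1) by (auto simp: v_def vec_eq_iff in_set_conv_nth)
    moreover have "adjacency_mat vs E *\<^sub>v v = k \<cdot>\<^sub>v v"
    proof (rule eq_vecI)
      fix i assume "i < dim_vec (k \<cdot>\<^sub>v v)"
      then have i: "i < ?n" by (simp add: v_def)
      then show "(adjacency_mat vs E *\<^sub>v v) $ i = (k \<cdot>\<^sub>v v) $ i"
        using bspec[OF f(2) nth_mem[OF i]]
        by (simp add: sum_eq adjacency_mat_def scalar_prod_def v_def)
    qed (simp add: v_def adjacency_mat_def)
    moreover have "v \<in> carrier_vec (dim_row (adjacency_mat vs E))" "dim_row (adjacency_mat vs E) = ?n"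
      by (simp_all add: v_def adjacency_mat_def)
    ultimately show ?L
      unfolding eigenvalue_def eigenvector_def by metis
  qed
qed

lemma graph_spectral_radius_eq:
  assumes "distinct vs"
  shows "graph_spectral_radius (set vs) E = spectral_radius (adjacency_mat vs E)"
proof -
  define ws where "ws = (SOME ws. distinct ws \<and> set ws = set vs)"
  have "distinct ws \<and> set ws = set vs"
    unfolding ws_def by (rule someI[of _ vs]) (simp add: assms)
  then have "eigenvalue (adjacency_mat ws E) k = eigenvalue (adjacency_mat vs E) k" for k
    using assms by (simp add: eigenvalue_adjacency_mat_iff)
  then have "spectrum (adjacency_mat ws E) = spectrum (adjacency_mat vs E)"
    by (auto simp: spectrum_def)
  then show ?thesis
    by (simp add: graph_spectral_radius_def spectral_radius_def ws_def)
qed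

end

theory Submission
  imports Defs "HOL-Analysis.Convex"
begin

text \<open>Let \<open>\<lambda>\<close> be the spectral radius, \<open>b\<close> the booksize, \<open>t\<close> the number of triangles, \<open>t z\<close> the number of
  triangles at \<open>z\<close>, and let \<open>g\<close> be a nonnegative vector with \<open>A g \<ge> \<lambda> g\<close>. Every triangle has an edge
  that does not cross the cut formed by \<open>N(z)\<close> and its complement, and every edge lies in at most \<open>b\<close>
  triangles. Hence at least \<open>t / b\<close> edges are uncut, and \<open>(A t) z \<le> t + b * t z\<close>. Averaging both facts
  over \<open>z\<close> with weights \<open>g\<close> gives \<open>t (1 / b - 2 / (\<lambda> - b)) \<le> m - \<lambda>\<^sup>2\<close>. If \<open>\<lambda>\<close> is close to \<open>sqrt m\<close>
  and \<open>b < (1/3 - \<epsilon>) sqrt m\<close>, the factor of \<open>t\<close> is positive and bounded away from zero at scale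
  \<open>1 / sqrt m\<close>, so there are few triangles, and the same average produces a vertex \<open>z\<close> whose cut
  misses few edges. The bipartite graph of cut edges then has a largest singular value close to the
  Frobenius norm of its matrix, hence nearly \<open>m\<^sup>2\<close> four-cycles, which for some edge \<open>u\<^sub>0 v\<^sub>0\<close> forces
  it to be close to the complete bipartite graph between \<open>N(v\<^sub>0)\<close> and \<open>N(u\<^sub>0)\<close>.\<close>

section \<open>Triangle counts and cuts by neighbourhoods\<close>

locale adjacency =
  fixes V :: "'a set" and a :: "'a \<Rightarrow> 'a \<Rightarrow> real"
  assumes finite_V: "finite V"
    and zero_one: "a u v = 0 \<or> a u v = 1"
    and sym: "a u v = a v u"
begin

definition codeg :: "'a \<Rightarrow> 'a \<Rightarrow> real" where
  "codeg u v = (\<Sum>w\<in>V. a u w * a v w)"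

text \<open>Twice the number of triangles at a vertex.\<close>

definition tri :: "'a \<Rightarrow> real" where
  "tri u = (\<Sum>v\<in>V. a u v * codeg u v)"

text \<open>Indicator that the pair \<open>u\<close>, \<open>v\<close> is not separated by the cut formed by the
  neighbourhood of \<open>z\<close> and its complement.\<close>

definition unsplit :: "'a \<Rightarrow> 'a \<Rightarrow> 'a \<Rightarrow> real" where
  "unsplit z u v = 1 - a z u - a z v + 2 * (a z u * a z v)"

text \<open>Ordered pairs are counted, so an uncut edge between distinct vertices enters
  twice.\<close>

definition uncut :: "'a \<Rightarrow> real" where
  "uncut z = (\<Sum>u\<in>V. \<Sum>v\<in>V. a u v * unsplit z u v)"

lemma nonneg [simp]: "0 \<le> a u v"
  using zero_one[of u v] by auto

lemma unsplit_zero_one: "unsplit z u v = 0 \<or> unsplit z u v = 1"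
  using zero_one[of z u] zero_one[of z v] by (auto simp: unsplit_def)

lemma unsplit_nonneg [simp]: "0 \<le> unsplit z u v"
  using unsplit_zero_one[of z u v] by auto

lemma codeg_nonneg [simp]: "0 \<le> codeg u v"
  by (simp add: codeg_def sum_nonneg)

lemma tri_nonneg [simp]: "0 \<le> tri u"
  by (simp add: tri_def sum_nonneg)

lemma codeg_sym: "codeg u v = codeg v u"
  by (simp add: codeg_def mult.commute)

text \<open>Renaming the summation variables shows that the three edges of an ordered triangle
  contribute equally. The identity carries a pointwise inequality about the edges of a triangle over
  to codegree-weighted sums over edges.\<close>

lemma sum_triangles:
  "(\<Sum>u\<in>V. \<Sum>v\<in>V. \<Sum>w\<in>V. a u v * a v w * a u w * (F u v + F v w + F u w)) =
     3 * (\<Sum>u\<in>V. \<Sum>v\<in>V. a u v * codeg u v * F u v)"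
proof -
  have 1: "(\<Sum>u\<in>V. \<Sum>v\<in>V. \<Sum>w\<in>V. a u v * a v w * a u w * F u v) =
      (\<Sum>u\<in>V. \<Sum>v\<in>V. a u v * codeg u v * F u v)"
    by (simp add: codeg_def sum_distrib_left sum_distrib_right mult_ac)
  have "(\<Sum>u\<in>V. \<Sum>v\<in>V. \<Sum>w\<in>V. a u v * a v w * a u w * F v w) =
      (\<Sum>v\<in>V. \<Sum>w\<in>V. \<Sum>u\<in>V. a u v * a v w * a u w * F v w)"
    by (subst sum.swap) (intro sum.cong refl sum.swap)
  also have "\<dots> = (\<Sum>u\<in>V. \<Sum>v\<in>V. a u v * codeg u v * F u v)"
    by (simp add: codeg_def sum_distrib_left sum_distrib_right mult_ac sym)
  finally have 2: "(\<Sum>u\<in>V. \<Sum>v\<in>V. \<Sum>w\<in>V. a u v * a v w * a u w * F v w) =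
      (\<Sum>u\<in>V. \<Sum>v\<in>V. a u v * codeg u v * F u v)" .
  have "(\<Sum>u\<in>V. \<Sum>v\<in>V. \<Sum>w\<in>V. a u v * a v w * a u w * F u w) =
      (\<Sum>u\<in>V. \<Sum>w\<in>V. \<Sum>v\<in>V. a u v * a v w * a u w * F u w)"
    by (intro sum.cong refl sum.swap)
  also have "\<dots> = (\<Sum>u\<in>V. \<Sum>v\<in>V. a u v * codeg u v * F u v)"
    by (simp add: codeg_def sum_distrib_left sum_distrib_right mult_ac sym)
  finally have 3: "(\<Sum>u\<in>V. \<Sum>v\<in>V. \<Sum>w\<in>V. a u v * a v w * a u w * F u w) =
      (\<Sum>u\<in>V. \<Sum>v\<in>V. a u v * codeg u v * F u v)" .
  show ?thesis
    by (simp add: distrib_left sum.distrib 1 2 3)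
qed

text \<open>Some edge of every triangle is not cut.\<close>

lemma sum_tri_le_uncut:
  "sum tri V \<le> 3 * (\<Sum>u\<in>V. \<Sum>v\<in>V. a u v * codeg u v * unsplit z u v)"
proof -
  have pt: "1 \<le> unsplit z u v + unsplit z v w + unsplit z u w" for u v w
    using zero_one[of z u] zero_one[of z v] zero_one[of z w] by (auto simp: unsplit_def)
  have "3 * sum tri V = (\<Sum>u\<in>V. \<Sum>v\<in>V. \<Sum>w\<in>V. a u v * a v w * a u w * (1 + 1 + 1))"
    by (subst sum_triangles) (simp add: tri_def)
  also have "\<dots> \<le> 3 * (\<Sum>u\<in>V. \<Sum>v\<in>V. \<Sum>w\<in>V.
      a u v * a v w * a u w * (unsplit z u v + unsplit z v w + unsplit z u w))"
    unfolding sum_distrib_left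
  proof (intro sum_mono)
    fix u v w
    have "a u v * a v w * a u w * 1 \<le>
        a u v * a v w * a u w * (unsplit z u v + unsplit z v w + unsplit z u w)"
      by (intro mult_left_mono pt) simp
    then show "a u v * a v w * a u w * (1 + 1 + 1) \<le>
        3 * (a u v * a v w * a u w * (unsplit z u v + unsplit z v w + unsplit z u w))"
      by argo
  qed
  also have "\<dots> = 9 * (\<Sum>u\<in>V. \<Sum>v\<in>V. a u v * codeg u v * unsplit z u v)"
    by (subst sum_triangles) simp
  finally show ?thesis by simp
qed

lemma sum_nbhd_pairs: "(\<Sum>u\<in>V. \<Sum>v\<in>V. a u v * (a z u * a z v)) = tri z"
  by (simp add: tri_def codeg_def sum_distrib_left mult_ac)

text \<open>The terms of \<open>unsplit\<close> are summed separately, and its two linear terms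
  agree by symmetry. The subtracted sum counts walks of length two from \<open>z\<close>; its
  weighted average is what the spectral radius bounds from below.\<close>

lemma uncut_eq:
  "uncut z = (\<Sum>u\<in>V. \<Sum>v\<in>V. a u v) - 2 * (\<Sum>u\<in>V. a z u * (\<Sum>v\<in>V. a u v)) + 2 * tri z"
proof -
  have "(\<Sum>u\<in>V. \<Sum>v\<in>V. a u v * a z v) = (\<Sum>u\<in>V. \<Sum>v\<in>V. a u v * a z u)"
    by (subst sum.swap) (simp add: sym)
  moreover have "(\<Sum>u\<in>V. \<Sum>v\<in>V. a u v * a z u) = (\<Sum>u\<in>V. a z u * (\<Sum>v\<in>V. a u v))"
    by (simp add: sum_distrib_left mult_ac)
  moreover have "uncut z = (\<Sum>u\<in>V. \<Sum>v\<in>V. a u v) - (\<Sum>u\<in>V. \<Sum>v\<in>V. a u v * a z u)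
      - (\<Sum>u\<in>V. \<Sum>v\<in>V. a u v * a z v) + 2 * tri z"
    unfolding sum_nbhd_pairs[symmetric]
    by (simp add: uncut_def unsplit_def algebra_simps sum.distrib sum_subtractf sum_distrib_left)
  ultimately show ?thesis by simp
qed

text \<open>For the first bound, every codegree in \<open>sum_tri_le_uncut\<close> is replaced by
  \<open>b\<close>. For the second, \<open>unsplit\<close> is expanded and \<open>b\<close> is used
  only for edges with both ends in the neighbourhood of \<open>z\<close>, whose ordered count is
  \<open>tri z\<close>; the linear terms keep their exact codegrees and yield the adjacency operator
  applied to \<open>tri\<close>.\<close>

lemma sum_tri_le_book:
  assumes "\<And>u v. u \<in> V \<Longrightarrow> v \<in> V \<Longrightarrow> a u v = 1 \<Longrightarrow> codeg u v \<le> b"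
  shows "sum tri V \<le> 3 * b * uncut z"
    and "3 * (\<Sum>u\<in>V. a z u * tri u) \<le> sum tri V + 3 * b * tri z"
proof -
  have bk: "a u v * codeg u v \<le> a u v * b" if "u \<in> V" "v \<in> V" for u v
    using assms[OF that] zero_one[of u v] by auto
  note sum_tri_le_uncut[of z]
  also have "(\<Sum>u\<in>V. \<Sum>v\<in>V. a u v * codeg u v * unsplit z u v) \<le>
      (\<Sum>u\<in>V. \<Sum>v\<in>V. a u v * b * unsplit z u v)"
    by (intro sum_mono mult_right_mono bk) simp_all
  also have "\<dots> = b * uncut z"
    by (simp add: uncut_def sum_distrib_left mult_ac)
  finally show "sum tri V \<le> 3 * b * uncut z" by simp
  have 1: "(\<Sum>u\<in>V. \<Sum>v\<in>V. a u v * codeg u v * a z u) = (\<Sum>u\<in>V. a z u * tri u)"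
    by (simp add: tri_def sum_distrib_left mult_ac)
  have 2: "(\<Sum>u\<in>V. \<Sum>v\<in>V. a u v * codeg u v * a z v) = (\<Sum>u\<in>V. a z u * tri u)"
    unfolding 1[symmetric] by (subst sum.swap) (simp add: sym codeg_sym)
  have "(\<Sum>u\<in>V. \<Sum>v\<in>V. a u v * codeg u v * (a z u * a z v)) \<le>
      (\<Sum>u\<in>V. \<Sum>v\<in>V. a u v * b * (a z u * a z v))"
    by (intro sum_mono mult_right_mono bk) simp_all
  also have "\<dots> = b * tri z"
    by (simp add: sum_nbhd_pairs[symmetric] sum_distrib_left mult_ac)
  finally have 3: "(\<Sum>u\<in>V. \<Sum>v\<in>V. a u v * codeg u v * (a z u * a z v)) \<le> b * tri z" .
  have "(\<Sum>u\<in>V. \<Sum>v\<in>V. a u v * codeg u v * unsplit z u v) =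
      sum tri V - (\<Sum>u\<in>V. \<Sum>v\<in>V. a u v * codeg u v * a z u)
      - (\<Sum>u\<in>V. \<Sum>v\<in>V. a u v * codeg u v * a z v)
      + 2 * (\<Sum>u\<in>V. \<Sum>v\<in>V. a u v * codeg u v * (a z u * a z v))"
    by (simp add: tri_def unsplit_def algebra_simps sum.distrib sum_subtractf sum_distrib_left)
  with 1 2 3 sum_tri_le_uncut[of z]
  show "3 * (\<Sum>u\<in>V. a z u * tri u) \<le> sum tri V + 3 * b * tri z" by simp
qed

section \<open>Averaging over neighbourhood cuts\<close>

text \<open>Both bounds of the preceding lemma are averaged over \<open>z\<close> with weights \<open>g z\<close>. They bound the
  weighted number of triangles from below and from above, and the bounds are incompatible
  for \<open>b < lam / 3\<close> unless there are few triangles.\<close>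

lemma exists_uncut_le:
  assumes g: "\<And>u. u \<in> V \<Longrightarrow> 0 \<le> g u" "\<exists>u\<in>V. g u \<noteq> 0"
    and sub: "\<And>u. u \<in> V \<Longrightarrow> lam * g u \<le> (\<Sum>v\<in>V. a u v * g v)"
    and bk: "\<And>u v. u \<in> V \<Longrightarrow> v \<in> V \<Longrightarrow> a u v = 1 \<Longrightarrow> codeg u v \<le> b"
    and b: "0 \<le> b" "3 * b < lam"
    and M: "(\<Sum>u\<in>V. \<Sum>v\<in>V. a u v) \<le> 2 * m"
  shows "\<exists>z\<in>V. uncut z * (lam - 3 * b) \<le> 2 * (m - lam\<^sup>2) * (lam - b)"
proof -
  define X where "X = sum g V"
  define Y where "Y = (\<Sum>z\<in>V. g z * tri z)"
  define \<tau> where "\<tau> = sum tri V"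
  \<comment> \<open>Symmetry of \<open>a\<close> moves the adjacency operator from \<open>g\<close>
    to \<open>f\<close>.\<close>
  have transfer: "lam * (\<Sum>u\<in>V. g u * f u) \<le> (\<Sum>z\<in>V. g z * (\<Sum>u\<in>V. a z u * f u))"
    if "\<And>u. u \<in> V \<Longrightarrow> 0 \<le> f u" for f
  proof -
    have "lam * (\<Sum>u\<in>V. g u * f u) = (\<Sum>u\<in>V. (lam * g u) * f u)"
      by (simp add: sum_distrib_left mult_ac)
    also have "\<dots> \<le> (\<Sum>u\<in>V. (\<Sum>v\<in>V. a u v * g v) * f u)"
      by (intro sum_mono mult_right_mono sub that)
    also have "\<dots> = (\<Sum>z\<in>V. g z * (\<Sum>u\<in>V. a z u * f u))"
      unfolding sum_distrib_left sum_distrib_right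
      by (subst sum.swap) (simp add: mult_ac sym)
    finally show ?thesis .
  qed
  have lam: "0 < lam" using b by simp
  have X: "0 < X"
    unfolding X_def using g finite_V by (metis less_le sum_nonneg_eq_0_iff sum_nonneg)
  \<comment> \<open>Two uses of \<open>transfer\<close>, for the constant 1 and for the degrees,
    bound the weighted number of walks of length two.\<close>
  have "lam * (lam * X) \<le> lam * (\<Sum>z\<in>V. g z * (\<Sum>u\<in>V. a z u))"
    using transfer[of "\<lambda>_. 1"] lam by (simp add: X_def)
  also have "\<dots> \<le> (\<Sum>z\<in>V. g z * (\<Sum>u\<in>V. a z u * (\<Sum>v\<in>V. a u v)))"
    by (intro transfer sum_nonneg) simp
  finally have w: "lam\<^sup>2 * X \<le> (\<Sum>z\<in>V. g z * (\<Sum>u\<in>V. a z u * (\<Sum>v\<in>V. a u v)))"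
    by (simp add: power2_eq_square mult_ac)
  define D where "D = (\<Sum>u\<in>V. \<Sum>v\<in>V. a u v)"
  define W where "W z = (\<Sum>u\<in>V. a z u * (\<Sum>v\<in>V. a u v))" for z
  have "(\<Sum>z\<in>V. g z * uncut z) = (\<Sum>z\<in>V. g z * D - 2 * (g z * W z) + 2 * (g z * tri z))"
    by (intro sum.cong refl) (simp add: uncut_eq D_def W_def algebra_simps)
  also have "\<dots> = X * D - 2 * (\<Sum>z\<in>V. g z * W z) + 2 * Y"
    by (simp add: X_def Y_def sum.distrib sum_subtractf sum_distrib_right flip: sum_distrib_left)
  also have "\<dots> \<le> X * (2 * m) - 2 * (lam\<^sup>2 * X) + 2 * Y"
  proof -
    have "X * D \<le> X * (2 * m)" "lam\<^sup>2 * X \<le> (\<Sum>z\<in>V. g z * W z)"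
      using M X w by (simp_all add: D_def W_def)
    then show ?thesis by linarith
  qed
  finally have U: "(\<Sum>z\<in>V. g z * uncut z) \<le> 2 * (m - lam\<^sup>2) * X + 2 * Y"
    by (simp add: algebra_simps)
  have "\<tau> * X = (\<Sum>z\<in>V. g z * \<tau>)"
    by (simp add: X_def sum_distrib_left mult.commute)
  also have "\<dots> \<le> (\<Sum>z\<in>V. g z * (3 * b * uncut z))"
    unfolding \<tau>_def by (intro sum_mono mult_left_mono sum_tri_le_book(1) bk g)
  also have "\<dots> = 3 * b * (\<Sum>z\<in>V. g z * uncut z)"
    by (simp add: sum_distrib_left mult_ac)
  finally have I: "\<tau> * X \<le> 3 * b * (\<Sum>z\<in>V. g z * uncut z)" .
  have "lam * Y \<le> (\<Sum>z\<in>V. g z * (\<Sum>u\<in>V. a z u * tri u))"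
    using transfer[of tri] by (simp add: Y_def)
  then have "3 * (lam * Y) \<le> (\<Sum>z\<in>V. g z * (3 * (\<Sum>u\<in>V. a z u * tri u)))"
    by (simp add: mult.left_commute[of _ 3] flip: sum_distrib_left)
  also have "\<dots> \<le> (\<Sum>z\<in>V. g z * (\<tau> + 3 * b * tri z))"
    unfolding \<tau>_def by (intro sum_mono mult_left_mono sum_tri_le_book(2) bk g)
  also have "\<dots> = \<tau> * X + 3 * b * Y"
    by (simp add: X_def Y_def algebra_simps sum.distrib sum_distrib_left)
  finally have II: "3 * (lam - b) * Y \<le> \<tau> * X" by (simp add: algebra_simps)
  define S where "S = (\<Sum>z\<in>V. g z * uncut z)"
  \<comment> \<open>\<open>I\<close> bounds \<open>\<tau> * X\<close> from above by \<open>S\<close>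
    and \<open>II\<close> from below by \<open>Y\<close>. With \<open>\<tau>\<close> eliminated,
    twice the resulting inequality absorbs the term \<open>2 * Y\<close> of
    \<open>U\<close>.\<close>
  have "(lam - b) * Y \<le> b * S" using I II by (simp add: S_def algebra_simps)
  moreover have "(lam - b) * S \<le> (lam - b) * (2 * (m - lam\<^sup>2) * X + 2 * Y)"
    using U b by (intro mult_left_mono) (simp_all add: S_def)
  ultimately have "S * (lam - 3 * b) \<le> 2 * (m - lam\<^sup>2) * (lam - b) * X"
    by (simp add: algebra_simps)
  then have *: "(\<Sum>z\<in>V. g z * (uncut z * (lam - 3 * b))) \<le>
      (\<Sum>z\<in>V. g z * (2 * (m - lam\<^sup>2) * (lam - b)))"
    by (simp add: S_def X_def sum_distrib_right sum_distrib_left mult_ac)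
  show ?thesis
  proof (rule ccontr)
    assume "\<not> ?thesis"
    then have lt: "2 * (m - lam\<^sup>2) * (lam - b) < uncut z * (lam - 3 * b)" if "z \<in> V" for z
      using that by force
    \<comment> \<open>A vertex of positive weight makes the averaged inequality strict.\<close>
    obtain u where "u \<in> V" "0 < g u" using g by (metis less_le)
    then have "(\<Sum>z\<in>V. g z * (2 * (m - lam\<^sup>2) * (lam - b))) <
        (\<Sum>z\<in>V. g z * (uncut z * (lam - 3 * b)))"
      using lt g finite_V
      by (intro sum_strict_mono_ex1 ballI mult_left_mono less_imp_le[OF lt] bexI[of _ u])
        (auto intro!: mult_strict_left_mono)
    with * show False by simp
  qed
qed

end

section \<open>Four-cycles and closeness to a complete bipartite graph\<close>

text \<open>Cauchy-Schwarz over \<open>R\<close> removes \<open>g\<close>, a second one over pairs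
  in \<open>S \<times> S\<close> removes \<open>f\<close>, and the arithmetic-geometric mean
  inequality merges the two norms. The last sum is the sum of the fourth powers of the singular
  values of \<open>h\<close>; for 0/1 entries it counts four-cycles, degenerate ones included. The
  sum of the norms suits the case where \<open>f\<close> and \<open>g\<close> restrict one vector to
  the two sides of a cut.\<close>

lemma four_cycles_ge:
  fixes h :: "'a \<Rightarrow> 'b \<Rightarrow> real"
  shows "16 * (\<Sum>u\<in>S. \<Sum>v\<in>R. h u v * f u * g v) ^ 4 \<le>
    ((\<Sum>u\<in>S. (f u)\<^sup>2) + (\<Sum>v\<in>R. (g v)\<^sup>2)) ^ 4 *
      (\<Sum>u\<in>S. \<Sum>u'\<in>S. (\<Sum>v\<in>R. h u v * h u' v)\<^sup>2)"
proof -
  define \<sigma> where "\<sigma> = (\<Sum>u\<in>S. \<Sum>v\<in>R. h u v * f u * g v)"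
  define P where "P = (\<Sum>u\<in>S. (f u)\<^sup>2)"
  define P' where "P' = (\<Sum>v\<in>R. (g v)\<^sup>2)"
  define Q where "Q = (\<Sum>u\<in>S. \<Sum>u'\<in>S. (\<Sum>v\<in>R. h u v * h u' v)\<^sup>2)"
  define \<tau> where "\<tau> = (\<Sum>v\<in>R. (\<Sum>u\<in>S. h u v * f u)\<^sup>2)"
  have nn: "0 \<le> P" "0 \<le> P'" "0 \<le> Q" "0 \<le> \<tau>"
    by (simp_all add: P_def P'_def Q_def \<tau>_def sum_nonneg)
  have "\<sigma> = (\<Sum>v\<in>R. g v * (\<Sum>u\<in>S. h u v * f u))"
    unfolding \<sigma>_def sum_distrib_left by (subst sum.swap) (simp add: mult_ac)
  then have \<sigma>: "\<sigma>\<^sup>2 \<le> P' * \<tau>"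
    using Cauchy_Schwarz_ineq_sum[of g "\<lambda>v. \<Sum>u\<in>S. h u v * f u" R] by (simp add: P'_def \<tau>_def)
  have "\<tau> = (\<Sum>v\<in>R. \<Sum>u\<in>S. \<Sum>u'\<in>S. (f u * f u') * (h u v * h u' v))"
    by (simp add: \<tau>_def power2_eq_square sum_product mult_ac)
  also have "\<dots> = (\<Sum>u\<in>S. \<Sum>u'\<in>S. (f u * f u') * (\<Sum>v\<in>R. h u v * h u' v))"
    unfolding sum_distrib_left
    by (subst sum.swap) (intro sum.cong refl sum.swap)
  also have "\<dots> = (\<Sum>(u, u')\<in>S \<times> S. (f u * f u') * (\<Sum>v\<in>R. h u v * h u' v))"
    by (simp add: sum.cartesian_product)
  finally have "\<tau>\<^sup>2 \<le> (\<Sum>(u, u')\<in>S \<times> S. (f u * f u')\<^sup>2) *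
      (\<Sum>(u, u')\<in>S \<times> S. (\<Sum>v\<in>R. h u v * h u' v)\<^sup>2)"
    using Cauchy_Schwarz_ineq_sum[of "\<lambda>(u, u'). f u * f u'"
        "\<lambda>(u, u'). \<Sum>v\<in>R. h u v * h u' v" "S \<times> S"]
    by (simp add: case_prod_beta)
  also have "(\<Sum>(u, u')\<in>S \<times> S. (f u * f u')\<^sup>2) = P\<^sup>2"
    by (simp add: P_def power2_eq_square sum_product sum.cartesian_product[symmetric] mult_ac)
  also have "(\<Sum>(u, u')\<in>S \<times> S. (\<Sum>v\<in>R. h u v * h u' v)\<^sup>2) = Q"
    by (simp add: Q_def sum.cartesian_product)
  finally have \<tau>: "\<tau>\<^sup>2 \<le> P\<^sup>2 * Q" .
  have "\<sigma> ^ 4 = (\<sigma>\<^sup>2)\<^sup>2" by simp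
  also have "\<dots> \<le> (P' * \<tau>)\<^sup>2" by (intro power_mono \<sigma>) simp
  also have "\<dots> = P'\<^sup>2 * \<tau>\<^sup>2" by (simp add: power_mult_distrib)
  also have "\<dots> \<le> P'\<^sup>2 * (P\<^sup>2 * Q)" by (intro mult_left_mono \<tau>) simp
  finally have "16 * \<sigma> ^ 4 \<le> (4 * (P * P'))\<^sup>2 * Q" by (simp add: power_mult_distrib mult_ac)
  also have "\<dots> \<le> ((P + P')\<^sup>2)\<^sup>2 * Q"
  proof (intro mult_right_mono power_mono)
    show "4 * (P * P') \<le> (P + P')\<^sup>2"
      using zero_le_power2[of "P - P'"] by (simp add: power2_eq_square algebra_simps)
  qed (use nn in simp_all)
  finally show ?thesis by (simp add: \<sigma>_def P_def P'_def Q_def)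
qed

text \<open>Averages over the pairs \<open>(u\<^sub>0, v\<^sub>0)\<close> with \<open>h u\<^sub>0 v\<^sub>0 = 1\<close>: three-edge paths and
  four-cycles through such a pair are both counted by pairs of edges.\<close>

lemma exists_near_rectangle:
  fixes h :: "'a \<Rightarrow> 'b \<Rightarrow> real"
  assumes fin: "finite S" "finite R"
    and zo: "\<And>u v. h u v = 0 \<or> h u v = 1"
  defines "M \<equiv> (\<Sum>u\<in>S. \<Sum>v\<in>R. h u v)"
  defines "Q \<equiv> (\<Sum>u\<in>S. \<Sum>u'\<in>S. (\<Sum>v\<in>R. h u v * h u' v)\<^sup>2)"
  assumes Q: "0 < Q"
  shows "0 < M"
    and "\<exists>u0\<in>S. \<exists>v0\<in>R. (\<Sum>u\<in>S. \<Sum>v\<in>R. \<bar>h u v - h u v0 * h u0 v\<bar>) * M \<le> 2 * (M\<^sup>2 - Q)"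
proof -
  have nn: "0 \<le> h u v" for u v using zo[of u v] by auto
  define F where "F u0 v0 = (\<Sum>u\<in>S. \<Sum>v\<in>R. \<bar>h u v - h u v0 * h u0 v\<bar>)" for u0 v0
  obtain u1 v1 where uv1: "u1 \<in> S" "v1 \<in> R" "h u1 v1 = 1"
  proof (rule ccontr)
    assume "\<not> thesis"
    then have "h u v = 0" if "u \<in> S" "v \<in> R" for u v
      using that zo[of u v] \<open>\<And>u1 v1. \<lbrakk>u1 \<in> S; v1 \<in> R; h u1 v1 = 1\<rbrakk> \<Longrightarrow> thesis\<close> by blast
    then have "Q = 0" by (simp add: Q_def)
    with Q show False by simp
  qed
  have M_prod: "M = (\<Sum>p\<in>S \<times> R. h (fst p) (snd p))"
    by (simp add: M_def sum.cartesian_product case_prod_beta)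
  show M: "0 < M"
    unfolding M_prod using uv1 fin nn by (intro sum_pos2[of _ "(u1, v1)"]) auto
  \<comment> \<open>For 0/1 values the distance of \<open>x\<close> and \<open>y\<close> is
    \<open>x + y - 2 * x * y\<close>. The three terms count pairs of edges, three-edge paths and
    four-cycles.\<close>
  have "(\<Sum>u0\<in>S. \<Sum>v0\<in>R. h u0 v0 * F u0 v0) =
      (\<Sum>u0\<in>S. \<Sum>v0\<in>R. \<Sum>u\<in>S. \<Sum>v\<in>R. h u0 v0 * h u v + h u0 v0 * (h u v0 * h u0 v)
        - 2 * (h u0 v0 * h u v * (h u v0 * h u0 v)))"
    unfolding F_def sum_distrib_left
  proof (intro sum.cong refl)
    fix u0 v0 u v
    show "h u0 v0 * \<bar>h u v - h u v0 * h u0 v\<bar> = h u0 v0 * h u v + h u0 v0 * (h u v0 * h u0 v)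
        - 2 * (h u0 v0 * h u v * (h u v0 * h u0 v))"
      using zo[of u v] zo[of u v0] zo[of u0 v] by auto
  qed
  \<comment> \<open>Dropping the middle edge \<open>h u0 v0\<close> of a path leaves two independent
    edges, so this term too sums to \<open>M\<^sup>2\<close>.\<close>
  also have "\<dots> \<le> (\<Sum>u0\<in>S. \<Sum>v0\<in>R. \<Sum>u\<in>S. \<Sum>v\<in>R. h u0 v0 * h u v + h u v0 * h u0 v
        - 2 * ((h u0 v0 * h u v0) * (h u0 v * h u v)))"
  proof (intro sum_mono)
    fix u0 v0 u v
    show "h u0 v0 * h u v + h u0 v0 * (h u v0 * h u0 v) - 2 * (h u0 v0 * h u v * (h u v0 * h u0 v))
        \<le> h u0 v0 * h u v + h u v0 * h u0 v - 2 * ((h u0 v0 * h u v0) * (h u0 v * h u v))"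
      using zo[of u0 v0] nn by (auto simp: mult_ac)
  qed
  also have "\<dots> = (\<Sum>u0\<in>S. \<Sum>v0\<in>R. \<Sum>u\<in>S. \<Sum>v\<in>R. h u0 v0 * h u v)
      + (\<Sum>u0\<in>S. \<Sum>v0\<in>R. \<Sum>u\<in>S. \<Sum>v\<in>R. h u v0 * h u0 v)
      - 2 * (\<Sum>u0\<in>S. \<Sum>v0\<in>R. \<Sum>u\<in>S. \<Sum>v\<in>R. (h u0 v0 * h u v0) * (h u0 v * h u v))"
    by (simp add: sum.distrib sum_subtractf sum_distrib_left)
  also have "(\<Sum>u0\<in>S. \<Sum>v0\<in>R. \<Sum>u\<in>S. \<Sum>v\<in>R. h u0 v0 * h u v) = M\<^sup>2"
  proof -
    have "(\<Sum>u0\<in>S. \<Sum>v0\<in>R. \<Sum>u\<in>S. \<Sum>v\<in>R. h u0 v0 * h u v) =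
        (\<Sum>u0\<in>S. \<Sum>v0\<in>R. h u0 v0 * M)"
      by (simp add: M_def sum_distrib_left)
    then show ?thesis
      by (simp add: M_def power2_eq_square sum_distrib_right)
  qed
  also have "(\<Sum>u0\<in>S. \<Sum>v0\<in>R. \<Sum>u\<in>S. \<Sum>v\<in>R. h u v0 * h u0 v) = M\<^sup>2"
  proof -
    have "(\<Sum>u0\<in>S. \<Sum>v0\<in>R. \<Sum>u\<in>S. \<Sum>v\<in>R. h u v0 * h u0 v) =
        (\<Sum>u0\<in>S. \<Sum>v\<in>R. h u0 v * M)"
      unfolding M_def sum_distrib_left
      by (subst (2) sum.swap, subst (3) sum.swap) (simp add: mult.commute sum.swap[of _ S R])
    then show ?thesis
      by (simp add: M_def power2_eq_square sum_distrib_right)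
  qed
  also have "(\<Sum>u0\<in>S. \<Sum>v0\<in>R. \<Sum>u\<in>S. \<Sum>v\<in>R. (h u0 v0 * h u v0) * (h u0 v * h u v)) = Q"
    unfolding Q_def power2_eq_square sum_product
    by (intro sum.cong refl sum.swap)
  finally have avg: "(\<Sum>u0\<in>S. \<Sum>v0\<in>R. h u0 v0 * F u0 v0) \<le> 2 * (M\<^sup>2 - Q)" by simp
  show "\<exists>u0\<in>S. \<exists>v0\<in>R. (\<Sum>u\<in>S. \<Sum>v\<in>R. \<bar>h u v - h u v0 * h u0 v\<bar>) * M \<le> 2 * (M\<^sup>2 - Q)"
  proof (rule ccontr)
    assume "\<not> ?thesis"
    then have lt: "2 * (M\<^sup>2 - Q) < F u v * M" if "u \<in> S" "v \<in> R" for u v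
      using that unfolding F_def by force
    have "(\<Sum>p\<in>S \<times> R. h (fst p) (snd p) * (2 * (M\<^sup>2 - Q))) <
        (\<Sum>p\<in>S \<times> R. h (fst p) (snd p) * (F (fst p) (snd p) * M))"
      using fin nn uv1 lt
      by (intro sum_strict_mono_ex1 ballI mult_left_mono less_imp_le[OF lt] bexI[of _ "(u1, v1)"])
        auto
    also have "\<dots> = (\<Sum>u0\<in>S. \<Sum>v0\<in>R. h u0 v0 * F u0 v0) * M"
      by (simp add: sum.cartesian_product case_prod_beta sum_distrib_left mult_ac)
    finally have "M * (2 * (M\<^sup>2 - Q)) < (\<Sum>u0\<in>S. \<Sum>v0\<in>R. h u0 v0 * F u0 v0) * M"
      by (simp add: M_prod sum_distrib_right)
    with avg M show False by (simp add: mult.commute)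
  qed
qed

section \<open>The spectrum of the cut and uncut parts\<close>

context adjacency
begin

text \<open>An ordered pair crosses the cut in one direction, in the other, or not at all; the two
  crossing sums agree by symmetry.\<close>

lemma sum_cut:
  defines "S z \<equiv> {u \<in> V. a z u = 1}"
  shows "(\<Sum>u\<in>V. \<Sum>v\<in>V. a u v * g u * g v) =
    2 * (\<Sum>u\<in>S z. \<Sum>v\<in>V - S z. a u v * g u * g v)
      + (\<Sum>u\<in>V. \<Sum>v\<in>V. a u v * unsplit z u v * (g u * g v))"
proof -
  let ?c = "\<Sum>u\<in>V. \<Sum>v\<in>V. a z u * (1 - a z v) * (a u v * g u * g v)"
  \<comment> \<open>On \<open>V\<close> the function \<open>a z\<close> is itself the indicator of
    \<open>S z\<close>.\<close>
  have S: "(\<Sum>u\<in>S z. f u) = (\<Sum>u\<in>V. a z u * f u)" for f :: "'a \<Rightarrow> real"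
    using finite_V zero_one[of z] unfolding S_def
    by (intro sum.mono_neutral_cong_left) fastforce+
  have R: "(\<Sum>u\<in>V - S z. f u) = (\<Sum>u\<in>V. (1 - a z u) * f u)" for f :: "'a \<Rightarrow> real"
    using finite_V zero_one[of z] unfolding S_def
    by (intro sum.mono_neutral_cong_left) fastforce+
  have c: "?c = (\<Sum>u\<in>S z. \<Sum>v\<in>V - S z. a u v * g u * g v)"
    by (simp add: S R sum_distrib_left mult_ac)
  have c': "(\<Sum>u\<in>V. \<Sum>v\<in>V. a z v * (1 - a z u) * (a u v * g u * g v)) = ?c"
    by (subst sum.swap) (simp add: sym mult_ac)
  have "(\<Sum>u\<in>V. \<Sum>v\<in>V. a u v * g u * g v) =
      ?c + (\<Sum>u\<in>V. \<Sum>v\<in>V. a z v * (1 - a z u) * (a u v * g u * g v))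
      + (\<Sum>u\<in>V. \<Sum>v\<in>V. a u v * unsplit z u v * (g u * g v))"
    unfolding sum.distrib[symmetric]
    by (intro sum.cong refl) (simp add: unsplit_def algebra_simps)
  with c c' show ?thesis by simp
qed

text \<open>The operator norm is at most the Frobenius norm, whose square is the sum of the entries
  for a 0/1 matrix.\<close>

lemma uncut_quadratic_form_le:
  "(\<Sum>u\<in>V. \<Sum>v\<in>V. a u v * unsplit z u v * (g u * g v)) \<le> sqrt (uncut z) * (\<Sum>u\<in>V. (g u)\<^sup>2)"
proof (rule power2_le_imp_le)
  let ?i = "\<lambda>(u, v). a u v * unsplit z u v"
  have i: "(?i p)\<^sup>2 = ?i p" for p
    using zero_one[of "fst p" "snd p"] unsplit_zero_one[of z "fst p" "snd p"]
    by (auto simp: case_prod_beta)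
  have "(\<Sum>p\<in>V \<times> V. ?i p * (case p of (u, v) \<Rightarrow> g u * g v))\<^sup>2 \<le>
      (\<Sum>p\<in>V \<times> V. (?i p)\<^sup>2) * (\<Sum>p\<in>V \<times> V. (case p of (u, v) \<Rightarrow> g u * g v)\<^sup>2)"
    by (rule Cauchy_Schwarz_ineq_sum)
  also have "(\<Sum>p\<in>V \<times> V. (?i p)\<^sup>2) = uncut z"
    by (simp only: i) (simp add: uncut_def sum.cartesian_product)
  also have "(\<Sum>p\<in>V \<times> V. (case p of (u, v) \<Rightarrow> g u * g v)\<^sup>2) = (\<Sum>u\<in>V. (g u)\<^sup>2)\<^sup>2"
    by (simp add: power2_eq_square sum_product sum.cartesian_product case_prod_beta mult_ac)
  finally show "(\<Sum>u\<in>V. \<Sum>v\<in>V. a u v * unsplit z u v * (g u * g v))\<^sup>2 \<le>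
      (sqrt (uncut z) * (\<Sum>u\<in>V. (g u)\<^sup>2))\<^sup>2"
    by (simp add: power_mult_distrib uncut_def sum_nonneg sum.cartesian_product case_prod_beta)
qed (simp add: uncut_def sum_nonneg)

text \<open>In the quadratic form of \<open>g\<close> the uncut pairs account for at most
  \<open>sqrt (uncut z)\<close> times the squared norm, so the cut carries the rest.
  \<open>four_cycles_ge\<close> turns this into a lower bound for the four-cycles of the cut, to
  which \<open>exists_near_rectangle\<close> applies.\<close>

lemma cut_near_rectangle:
  fixes z :: 'a
  defines "S \<equiv> {u \<in> V. a z u = 1}"
  assumes g: "\<exists>u\<in>V. g u \<noteq> 0" "\<And>u. u \<in> V \<Longrightarrow> 0 \<le> g u"
    and sub: "\<And>u. u \<in> V \<Longrightarrow> lam * g u \<le> (\<Sum>v\<in>V. a u v * g v)"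
    and M: "(\<Sum>u\<in>V. \<Sum>v\<in>V. a u v) \<le> 2 * m"
    and \<theta>: "sqrt (uncut z) < lam" "(1 - \<theta>) * m\<^sup>2 \<le> (lam - sqrt (uncut z)) ^ 4" "\<theta> \<le> 1"
  shows "\<exists>u0\<in>S. \<exists>v0\<in>V - S. (\<Sum>u\<in>S. \<Sum>v\<in>V - S. \<bar>a u v - a u v0 * a u0 v\<bar>) \<le> 2 * \<theta> * m"
proof -
  define \<sigma> where "\<sigma> = (\<Sum>u\<in>S. \<Sum>v\<in>V - S. a u v * g u * g v)"
  define H where "H = (\<Sum>u\<in>S. \<Sum>v\<in>V - S. a u v)"
  define P where "P = (\<Sum>u\<in>V. (g u)\<^sup>2)"
  define Q where "Q = (\<Sum>u\<in>S. \<Sum>u'\<in>S. (\<Sum>v\<in>V - S. a u v * a u' v)\<^sup>2)"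
  define l where "l = lam - sqrt (uncut z)"
  have l: "0 < l" using \<theta> by (simp add: l_def)
  have fin: "finite S" "finite (V - S)" using finite_V by (simp_all add: S_def)
  have P: "0 < P"
    using g finite_V unfolding P_def by (metis sum_pos2 zero_le_power2 zero_less_power2)
  have Psplit: "(\<Sum>u\<in>S. (g u)\<^sup>2) + (\<Sum>u\<in>V - S. (g u)\<^sup>2) = P"
    unfolding P_def using finite_V by (subst add.commute, intro sum.subset_diff[symmetric])
      (auto simp: S_def)
  have "lam * P = (\<Sum>u\<in>V. g u * (lam * g u))"
    by (simp add: P_def sum_distrib_left power2_eq_square mult_ac)
  also have "\<dots> \<le> (\<Sum>u\<in>V. g u * (\<Sum>v\<in>V. a u v * g v))"
    by (intro sum_mono mult_left_mono sub g)
  also have "\<dots> = (\<Sum>u\<in>V. \<Sum>v\<in>V. a u v * g u * g v)"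
    by (simp add: sum_distrib_left mult_ac)
  also have "\<dots> \<le> 2 * \<sigma> + sqrt (uncut z) * P"
    using sum_cut[of g z] uncut_quadratic_form_le[of z g] by (simp add: \<sigma>_def P_def S_def)
  finally have "l * P \<le> 2 * \<sigma>" by (simp add: l_def algebra_simps)
  then have "(l * P) ^ 4 \<le> (2 * \<sigma>) ^ 4"
    using l P by (intro power_mono) simp_all
  also have "\<dots> \<le> P ^ 4 * Q"
    using four_cycles_ge[where S = S and R = "V - S" and h = a and f = g and g = g] by (simp add: \<sigma>_def Psplit Q_def power_mult_distrib)
  finally have Q: "l ^ 4 \<le> Q"
    using P by (simp add: power_mult_distrib mult.commute)
  moreover have "0 < l ^ 4" using l by simp
  ultimately have Qpos: "0 < Q" by linarith
  note near = exists_near_rectangle[OF fin, of a, OF zero_one, folded Q_def H_def, OF Qpos]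
  have H: "0 < H" by (rule near(1))
  \<comment> \<open>The constant vector in \<open>sum_cut\<close> counts edges: each cut edge is
    counted once in \<open>H\<close> and twice in the full sum.\<close>
  have "2 * H + uncut z \<le> 2 * m"
    using M sum_cut[of "\<lambda>_. 1" z] by (simp add: H_def S_def uncut_def)
  moreover have "0 \<le> uncut z" by (simp add: uncut_def sum_nonneg)
  ultimately have Hm: "H \<le> m" by simp
  obtain u0 v0 where uv: "u0 \<in> S" "v0 \<in> V - S"
    and F: "(\<Sum>u\<in>S. \<Sum>v\<in>V - S. \<bar>a u v - a u v0 * a u0 v\<bar>) * H \<le> 2 * (H\<^sup>2 - Q)"
    using near(2) by blast
  note F
  also have "2 * (H\<^sup>2 - Q) \<le> 2 * (H\<^sup>2 - (1 - \<theta>) * m\<^sup>2)"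
    using Q \<theta>(2) by (simp add: l_def)
  \<comment> \<open>\<open>H \<le> m\<close> and \<open>\<theta> \<le> 1\<close> bring out a common
    factor \<open>H\<close>, which then cancels.\<close>
  also have "\<dots> \<le> 2 * (H * m - (1 - \<theta>) * (m * H))"
  proof -
    have "H\<^sup>2 \<le> H * m" "(1 - \<theta>) * (m * H) \<le> (1 - \<theta>) * m\<^sup>2"
      using H Hm \<theta>(3) unfolding power2_eq_square
      by (intro mult_left_mono; simp)+
    then show ?thesis by simp
  qed
  also have "\<dots> = (2 * \<theta> * m) * H" by (simp add: algebra_simps)
  finally have "(\<Sum>u\<in>S. \<Sum>v\<in>V - S. \<bar>a u v - a u v0 * a u0 v\<bar>) \<le> 2 * \<theta> * m"
    using H by simp
  with uv show ?thesis by blast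
qed

end

section \<open>Translation of edge sets and the spectral radius into sums\<close>

text \<open>The entrywise absolute value of a complex eigenvector to an eigenvalue of maximal modulus.
  It need not be an eigenvector; the inequality is all that is used of Perron--Frobenius theory.\<close>

lemma spectral_radius_subinvariant:
  fixes V :: "'a set"
  assumes "finite V" "V \<noteq> {}"
  obtains g :: "'a \<Rightarrow> real" where "\<And>u. 0 \<le> g u" "\<exists>u\<in>V. g u \<noteq> 0"
    "\<And>u. u \<in> V \<Longrightarrow> graph_spectral_radius V E * g u \<le> (\<Sum>v\<in>V. (if {u, v} \<in> E then 1 else 0) * g v)"
proof -
  obtain vs where vs: "distinct vs" "set vs = V"
    using finite_distinct_list[OF assms(1)] by blast
  let ?A = "adjacency_mat vs E"
  have A: "?A \<in> carrier_mat (length vs) (length vs)" by (simp add: adjacency_mat_def)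
  have "length vs \<noteq> 0" using vs assms by auto
  then obtain k where k: "k \<in> spectrum ?A" "norm k = spectral_radius ?A"
    using spectral_radius_mem_max(1)[OF A] by auto
  then obtain f where f: "\<exists>u\<in>V. f u \<noteq> 0"
    "\<forall>u\<in>V. (\<Sum>w\<in>V. (if {u, w} \<in> E then 1 else 0) * f w) = k * f u"
    using eigenvalue_adjacency_mat_iff[OF vs(1)] vs(2) by (auto simp: spectrum_def)
  have k_eq: "norm k = graph_spectral_radius V E"
    using k(2) graph_spectral_radius_eq[OF vs(1), of E] vs(2) by simp
  show thesis
  proof (rule that[of "\<lambda>u. norm (f u)"])
    fix u assume u: "u \<in> V"
    have "graph_spectral_radius V E * norm (f u) =
        norm (\<Sum>w\<in>V. (if {u, w} \<in> E then 1 else 0) * f w)"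
      using f(2) u k_eq by (simp add: norm_mult)
    also have "\<dots> \<le> (\<Sum>w\<in>V. norm ((if {u, w} \<in> E then 1 else 0) * f w))"
      by (rule norm_sum)
    also have "\<dots> = (\<Sum>w\<in>V. (if {u, w} \<in> E then 1 else 0) * norm (f w))"
      by (intro sum.cong) auto
    finally show "graph_spectral_radius V E * norm (f u) \<le>
        (\<Sum>v\<in>V. (if {u, v} \<in> E then 1 else 0) * norm (f v))" .
  qed (use f in auto)
qed

lemma simple_graph_edge:
  assumes "simple_graph V E" "{u, v} \<in> E"
  shows "u \<in> V" "v \<in> V" "u \<noteq> v"
  using assms by (auto simp: simple_graph_def)

lemma finite_edges: "simple_graph V E \<Longrightarrow> finite E"
  by (rule finite_subset[of _ "Pow V"]) (auto simp: simple_graph_def)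

text \<open>The map from ordered pairs to edges has fibres of size two.\<close>

lemma sum_degrees_le:
  assumes G: "simple_graph V E"
  shows "(\<Sum>u\<in>V. \<Sum>v\<in>V. if {u, v} \<in> E then 1 else (0::real)) \<le> 2 * real (card E)"
proof -
  let ?D = "{(u, v) \<in> V \<times> V. {u, v} \<in> E}"
  have V: "finite V" using G by (simp add: simple_graph_def)
  have "?D \<subseteq> (\<Union>e\<in>E. {(u, v). {u, v} = e})" by auto
  moreover have two: "card {(u, v). {u, v} = e} = 2 \<and> finite {(u, v). {u, v} = e}"
    if "e \<in> E" for e
  proof -
    obtain x y where "e = {x, y}" "x \<noteq> y"
      using G \<open>e \<in> E\<close> by (auto simp: simple_graph_def card_2_iff)
    then have "{(u, v). {u, v} = e} = {(x, y), (y, x)}"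
      by (auto simp: doubleton_eq_iff)
    then show ?thesis using \<open>x \<noteq> y\<close> by simp
  qed
  ultimately have "card ?D \<le> card (\<Union>e\<in>E. {(u, v). {u, v} = e})"
    using finite_edges[OF G] by (intro card_mono finite_UN_I) auto
  also have "\<dots> \<le> (\<Sum>e\<in>E. card {(u, v). {u, v} = e})"
    by (rule card_UN_le[OF finite_edges[OF G]])
  also have "\<dots> = 2 * card E" using two by simp
  finally have "card ?D \<le> 2 * card E" .
  moreover have "(\<Sum>u\<in>V. \<Sum>v\<in>V. if {u, v} \<in> E then 1 else (0::real)) = real (card ?D)"
  proof -
    have "(\<Sum>u\<in>V. \<Sum>v\<in>V. if {u, v} \<in> E then 1 else (0::real)) =
        (\<Sum>p\<in>V \<times> V. if {fst p, snd p} \<in> E then 1 else 0)"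
      by (simp add: sum.cartesian_product case_prod_beta)
    also have "\<dots> = (\<Sum>p\<in>?D. 1)"
    proof (intro sum.mono_neutral_cong_right ballI)
      fix p assume "p \<in> V \<times> V - ?D"
      then show "(if {fst p, snd p} \<in> E then 1 else (0::real)) = 0" by (cases p) simp
    next
      fix p assume "p \<in> ?D"
      then show "(if {fst p, snd p} \<in> E then 1 else (0::real)) = 1" by (cases p) simp
    qed (use V in auto)
    finally show ?thesis by simp
  qed
  ultimately show ?thesis by simp
qed

lemma card_common_nbhd_le_booksize:
  assumes G: "simple_graph V E" and e: "{u, v} \<in> E"
  shows "card (nbhd E u \<inter> nbhd E v) \<le> booksize E"
proof -
  have "{card (nbhd E u \<inter> nbhd E v) | u v. {u, v} \<in> E} \<subseteq>
      (\<lambda>(u, v). card (nbhd E u \<inter> nbhd E v)) ` (V \<times> V)"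
    using simple_graph_edge[OF G] by fastforce
  moreover have "finite V" using G by (simp add: simple_graph_def)
  ultimately have "finite {card (nbhd E u \<inter> nbhd E v) | u v. {u, v} \<in> E}"
    by (meson finite_SigmaI finite_imageI finite_subset)
  then show ?thesis unfolding booksize_def using e by (intro Max_ge) auto
qed

text \<open>Identifies \<open>codeg\<close> with the quantity maximised by
  \<open>booksize\<close>.\<close>

lemma sum_common_nbhd:
  assumes G: "simple_graph V E"
  shows "(\<Sum>w\<in>V. (if {u, w} \<in> E then 1 else 0) * (if {v, w} \<in> E then 1 else (0::real))) =
    real (card (nbhd E u \<inter> nbhd E v))"
proof -
  have "(\<Sum>w\<in>V. (if {u, w} \<in> E then 1 else 0) * (if {v, w} \<in> E then 1 else (0::real))) =
      (\<Sum>w\<in>nbhd E u \<inter> nbhd E v. 1)"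
    using G simple_graph_edge[OF G]
    by (intro sum.mono_neutral_cong_right) (auto simp: nbhd_def simple_graph_def)
  then show ?thesis by simp
qed

section \<open>Choice of the constants and of the two sides\<close>

theorem theorem1p9:
  shows "\<forall>\<epsilon>::real. \<epsilon> > 0 \<longrightarrow> (\<exists>\<delta>::real. \<delta> > 0 \<and>
    (\<forall>(V :: 'a set) E.
       simple_graph V E \<and> card E \<ge> 1 \<and>
       graph_spectral_radius V E \<ge> (1 - \<delta>) * sqrt (real (card E)) \<longrightarrow>
         real (booksize E) \<ge> (1 / 3 - \<epsilon>) * sqrt (real (card E)) \<or>
         (\<exists>A B. A \<subseteq> V \<and> B \<subseteq> V \<and> A \<inter> B = {} \<and>
            real (card (sym_diff E (bipartite_edges A B))) \<le> \<epsilon> * real (card E))))"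
proof (intro allI impI)
  fix \<epsilon> :: real assume \<epsilon>: "\<epsilon> > 0"
  \<comment> \<open>Below, \<open>uncut z\<close> is at most
    \<open>(2 * \<delta> / \<epsilon>) * m\<close>; this choice makes that
    \<open>(\<epsilon> / 50)\<^sup>2 * m\<close>.\<close>
  define \<delta> where "\<delta> = \<epsilon> ^ 3 / 5000"
  have rectangle: "\<exists>A B. A \<subseteq> V \<and> B \<subseteq> V \<and> A \<inter> B = {} \<and>
      real (card (sym_diff E (bipartite_edges A B))) \<le> \<epsilon> * real (card E)"
    if G: "simple_graph V E" and E: "card E \<ge> 1"
      and lam: "graph_spectral_radius V E \<ge> (1 - \<delta>) * sqrt (real (card E))"
      and bk: "real (booksize E) < (1 / 3 - \<epsilon>) * sqrt (real (card E))" for V :: "'a set" and E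
  proof -
    define a where "a u v = (if {u, v} \<in> E then 1 else (0::real))" for u v
    define m where "m = real (card E)"
    define s where "s = sqrt m"
    define l where "l = graph_spectral_radius V E"
    define b where "b = real (booksize E)"
    have finV: "finite V" using G by (simp add: simple_graph_def)
    interpret adjacency V a
      by unfold_locales (auto simp: finV a_def insert_commute)
    have m: "m \<ge> 1" using E by (simp add: m_def)
    then have s: "s \<ge> 1" "s * s = m" "s\<^sup>2 = m" by (simp_all add: s_def)
    have b: "0 \<le> b" "b < (1 / 3 - \<epsilon>) * s" using bk by (simp_all add: b_def s_def m_def)
    \<comment> \<open>Since the booksize is nonnegative, its upper bound forces
      \<open>\<epsilon> < 1 / 3\<close>.\<close>
    then have "0 < (1 / 3 - \<epsilon>) * s" by linarith
    then have \<epsilon>3: "\<epsilon> < 1 / 3" using s by (simp add: zero_less_mult_iff)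
    have "\<epsilon> ^ 3 \<le> \<epsilon> * 1"
      unfolding power3_eq_cube mult.assoc
      by (intro mult_left_mono mult_le_one) (use \<epsilon> \<epsilon>3 in simp_all)
    then have \<delta>: "0 \<le> \<delta>" "\<delta> \<le> \<epsilon> / 5000" using \<epsilon> by (simp_all add: \<delta>_def)
    have "E \<noteq> {}" using E by auto
    then have "V \<noteq> {}" using G by (fastforce simp: simple_graph_def)
    then obtain g where g: "\<And>u. 0 \<le> g u" "\<exists>u\<in>V. g u \<noteq> 0"
      and sub: "\<And>u. u \<in> V \<Longrightarrow> l * g u \<le> (\<Sum>v\<in>V. a u v * g v)"
      unfolding l_def a_def by (rule spectral_radius_subinvariant[OF finV, of E]) blast
    have D: "(\<Sum>u\<in>V. \<Sum>v\<in>V. a u v) \<le> 2 * m"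
      using sum_degrees_le[OF G] by (simp add: a_def m_def)
    have cod: "codeg u v \<le> b" if "a u v = 1" for u v
      using that card_common_nbhd_le_booksize[OF G, of u v] sum_common_nbhd[OF G, of u v]
      by (auto simp: codeg_def a_def b_def split: if_splits)
    have ls: "(1 - \<delta>) * s \<le> l" using lam by (simp add: l_def s_def m_def)
    have gap: "2 * \<epsilon> * s \<le> l - 3 * b"
    proof -
      have "2 * \<epsilon> * s \<le> (1 - \<delta>) * s - 3 * ((1 / 3 - \<epsilon>) * s)"
        using mult_right_mono[of "\<delta>" \<epsilon> s] \<delta> \<epsilon> s by (simp add: algebra_simps)
      then show ?thesis using ls b by linarith
    qed
    have "0 < 2 * \<epsilon> * s" using \<epsilon> s by simp
    then have lb: "3 * b < l" using gap by linarith
    obtain z where z: "z \<in> V" and uz: "uncut z * (l - 3 * b) \<le> 2 * (m - l\<^sup>2) * (l - b)"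
      using exists_uncut_le[of g l b m] g sub cod b(1) lb D by blast
    have uncut0: "0 \<le> uncut z" by (simp add: uncut_def sum_nonneg)
    have "uncut z * (2 * \<epsilon> * s) \<le> 2 * (m - l\<^sup>2) * (l - b)"
      using mult_left_mono[OF gap uncut0] uz by linarith
    \<comment> \<open>If \<open>l \<le> s\<close>, the factors are bounded by
      \<open>2 * \<delta> * m\<close> and \<open>s\<close>. Otherwise \<open>m - l\<^sup>2\<close>
      is not positive and neither is the product.\<close>
    also have "\<dots> \<le> 4 * \<delta> * m * s"
    proof (cases "l \<le> s")
      case True
      have "(1 - 2 * \<delta>) * m \<le> (1 - \<delta>)\<^sup>2 * m"
        using m by (intro mult_right_mono) (simp_all add: power2_eq_square algebra_simps)
      also have "\<dots> = ((1 - \<delta>) * s)\<^sup>2"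
        by (simp add: power_mult_distrib s(3))
      also have "\<dots> \<le> l\<^sup>2"
        using ls \<delta> \<epsilon>3 s by (intro power_mono) simp_all
      finally have ml: "m - l\<^sup>2 \<le> 2 * \<delta> * m" by (simp add: algebra_simps)
      have "0 \<le> l - b" "l - b \<le> s" using True b lb by linarith+
      then have "2 * (m - l\<^sup>2) * (l - b) \<le> 2 * (2 * \<delta> * m) * s"
        by (intro mult_mono[of "2 * (m - l\<^sup>2)"]) (use ml \<delta> m in simp_all)
      then show ?thesis by simp
    next
      case False
      then have "m \<le> l\<^sup>2" using s power_mono[of s l 2] by simp
      then have "2 * (m - l\<^sup>2) * (l - b) \<le> 0"
        using b lb by (intro mult_nonpos_nonneg[of "2 * (m - l\<^sup>2)"]) simp_all
      then show ?thesis using \<delta> m s by (smt (verit) mult_nonneg_nonneg)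
    qed
    also have "\<dots> = ((\<epsilon> / 50)\<^sup>2 * m) * (2 * \<epsilon> * s)"
      by (simp add: \<delta>_def power2_eq_square power3_eq_cube)
    finally have uncut_le: "uncut z \<le> (\<epsilon> / 50)\<^sup>2 * m"
      using \<open>0 < 2 * \<epsilon> * s\<close> by (rule mult_right_le_imp_le)
    then have "sqrt (uncut z) \<le> (\<epsilon> / 50) * s"
      using \<epsilon> s by (intro real_le_lsqrt) (simp_all add: power_mult_distrib power_divide)
    moreover have "\<delta> * s \<le> (\<epsilon> / 50) * s"
      using \<delta> \<epsilon> s by (intro mult_right_mono) linarith+
    ultimately have gap2: "(1 - \<epsilon> / 25) * s \<le> l - sqrt (uncut z)"
      using ls by (simp add: algebra_simps)
    \<comment> \<open>Bernoulli's inequality for the fourth power of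
      \<open>1 - \<epsilon> / 25\<close>.\<close>
    define \<theta> where "\<theta> = 4 * \<epsilon> / 25"
    have "(1 - \<theta>) * m\<^sup>2 \<le> (l - sqrt (uncut z)) ^ 4"
    proof -
      have "1 - 4 * (\<epsilon> / 25) \<le> (1 - \<epsilon> / 25) ^ 4"
        using Bernoulli_inequality[of "- (\<epsilon> / 25)" 4] \<epsilon>3 by simp
      then have "(1 - \<theta>) * m\<^sup>2 \<le> (1 - \<epsilon> / 25) ^ 4 * m\<^sup>2"
        by (intro mult_right_mono) (simp_all add: \<theta>_def)
      also have "\<dots> = ((1 - \<epsilon> / 25) * s) ^ 4"
        by (simp add: power_mult_distrib s(3)[symmetric])
      also have "\<dots> \<le> (l - sqrt (uncut z)) ^ 4"
        using gap2 \<epsilon>3 s by (intro power_mono) simp_all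
      finally show ?thesis .
    qed
    moreover have "0 < (1 - \<epsilon> / 25) * s" using \<epsilon>3 s by simp
    ultimately obtain u0 v0 where
      F: "(\<Sum>u\<in>{u \<in> V. a z u = 1}. \<Sum>v\<in>V - {u \<in> V. a z u = 1}. \<bar>a u v - a u v0 * a u0 v\<bar>) \<le> 2 * \<theta> * m"
      using cut_near_rectangle[of g l m z \<theta>] g sub D gap2 \<epsilon>3
      by (fastforce simp: \<theta>_def)
    define S where "S = {u \<in> V. a z u = 1}"
    \<comment> \<open>The neighbourhoods of \<open>v0\<close> and \<open>u0\<close>, restricted to
      opposite sides of the cut to make them disjoint. On \<open>S \<times> (V - S)\<close> the
      product \<open>a u v0 * a u0 v\<close> is the indicator of
      \<open>A \<times> B\<close>.\<close>
    define A where "A = {u \<in> S. a u v0 = 1}"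
    define B where "B = {v \<in> V - S. a u0 v = 1}"
    let ?U = "{p \<in> V \<times> V. a (fst p) (snd p) * unsplit z (fst p) (snd p) = 1}"
    let ?R = "{p \<in> S \<times> (V - S). a (fst p) (snd p) \<noteq> a (fst p) v0 * a u0 (snd p)}"
    have fin: "finite ?U" "finite ?R" using finV by (simp_all add: S_def)
    have U: "real (card ?U) = uncut z"
    proof -
      have "uncut z = (\<Sum>p\<in>V \<times> V. a (fst p) (snd p) * unsplit z (fst p) (snd p))"
        by (simp add: uncut_def sum.cartesian_product case_prod_beta)
      also have "\<dots> = (\<Sum>p\<in>?U. 1)"
      proof (intro sum.mono_neutral_cong_right ballI)
        fix p assume "p \<in> V \<times> V - ?U"
        then show "a (fst p) (snd p) * unsplit z (fst p) (snd p) = 0"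
          using zero_one[of "fst p" "snd p"] unsplit_zero_one[of z "fst p" "snd p"] by auto
      qed (use finV in auto)
      finally show ?thesis by simp
    qed
    have R: "real (card ?R) \<le> 2 * \<theta> * m"
    proof -
      have "real (card ?R) = (\<Sum>p\<in>?R. 1)" by simp
      also have "\<dots> = (\<Sum>p\<in>S \<times> (V - S). \<bar>a (fst p) (snd p) - a (fst p) v0 * a u0 (snd p)\<bar>)"
      proof (intro sum.mono_neutral_cong_left ballI)
        show "finite (S \<times> (V - S))" using finV by (simp add: S_def)
        fix p assume "p \<in> ?R"
        then show "1 = \<bar>a (fst p) (snd p) - a (fst p) v0 * a u0 (snd p)\<bar>"
          using zero_one[of "fst p" "snd p"] zero_one[of "fst p" v0] zero_one[of u0 "snd p"] by auto
      qed auto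
      also have "\<dots> \<le> 2 * \<theta> * m"
        using F by (simp add: S_def sum.cartesian_product case_prod_beta)
      finally show ?thesis .
    qed
    \<comment> \<open>All edges between \<open>A\<close> and \<open>B\<close> cross the cut. Hence a
      difference on one side is an uncut edge of the graph, in \<open>?U\<close>, and a crossing
      difference is a wrong entry of the rectangle, in \<open>?R\<close>.\<close>
    have "sym_diff E (bipartite_edges A B) \<subseteq> (\<lambda>p. {fst p, snd p}) ` (?U \<union> ?R)"
    proof
      fix e assume e: "e \<in> sym_diff E (bipartite_edges A B)"
      have "\<exists>u\<in>V. \<exists>v\<in>V. e = {u, v}"
      proof (cases "e \<in> E")
        case True
        then obtain u v where "e = {u, v}" using G by (auto simp: simple_graph_def card_2_iff)
        then show ?thesis using simple_graph_edge[OF G] True by blast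
      next
        case False
        then show ?thesis using e by (auto simp: bipartite_edges_def A_def B_def S_def)
      qed
      then obtain u v where uv: "u \<in> V" "v \<in> V" "e = {u, v}" by blast
      show "e \<in> (\<lambda>p. {fst p, snd p}) ` (?U \<union> ?R)"
      proof (cases "u \<in> S \<longleftrightarrow> v \<in> S")
        case True
        then have "unsplit z u v = 1"
          using zero_one[of z u] zero_one[of z v] uv by (auto simp: unsplit_def S_def)
        moreover have "e \<notin> bipartite_edges A B"
          using True uv by (auto simp: bipartite_edges_def A_def B_def doubleton_eq_iff)
        ultimately have p: "(u, v) \<in> ?U" using e uv by (simp add: a_def)
        show ?thesis by (rule image_eqI[OF _ UnI1[OF p]]) (simp add: uv)
      next
        case False
        then obtain x y where xy: "x \<in> S" "y \<in> V - S" "e = {x, y}"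
          using uv by blast
        have "e \<in> bipartite_edges A B \<longleftrightarrow> x \<in> A \<and> y \<in> B"
          using xy by (auto simp: bipartite_edges_def A_def B_def doubleton_eq_iff)
        moreover have "e \<in> E \<longleftrightarrow> a x y = 1" using xy by (simp add: a_def)
        ultimately have p: "(x, y) \<in> ?R"
          using e xy zero_one[of x y] zero_one[of x v0] zero_one[of u0 y]
          by (auto simp: A_def B_def)
        show ?thesis by (rule image_eqI[OF _ UnI2[OF p]]) (simp add: xy)
      qed
    qed
    then have "card (sym_diff E (bipartite_edges A B)) \<le> card ((\<lambda>p. {fst p, snd p}) ` (?U \<union> ?R))"
      using fin by (intro card_mono) simp_all
    also have "\<dots> \<le> card ?U + card ?R"
      using fin by (meson card_Un_le card_image_le finite_UnI le_trans)
    finally have "real (card (sym_diff E (bipartite_edges A B))) \<le> uncut z + 2 * \<theta> * m"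
      using U R by linarith
    also have "\<dots> \<le> (\<epsilon> * (1 / 2500) + 2 * \<theta>) * m"
    proof -
      have "(\<epsilon> / 50)\<^sup>2 \<le> \<epsilon> * (1 / 2500)"
        using \<epsilon> \<epsilon>3 by (simp add: power2_eq_square)
      then have "(\<epsilon> / 50)\<^sup>2 * m \<le> \<epsilon> * (1 / 2500) * m"
        using m by (intro mult_right_mono) simp_all
      then show ?thesis using uncut_le by (simp add: algebra_simps)
    qed
    \<comment> \<open>The coefficient of \<open>\<epsilon>\<close> is 1/2500 + 8/25, which is below
      1.\<close>
    also have "\<dots> \<le> \<epsilon> * m"
      using \<epsilon> m by (intro mult_right_mono) (simp_all add: \<theta>_def)
    finally have "real (card (sym_diff E (bipartite_edges A B))) \<le> \<epsilon> * real (card E)"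
      by (simp add: m_def)
    moreover have "A \<subseteq> V" "B \<subseteq> V" "A \<inter> B = {}" by (auto simp: A_def B_def S_def)
    ultimately show ?thesis by blast
  qed
  show "\<exists>\<delta>::real. \<delta> > 0 \<and>
    (\<forall>(V :: 'a set) E.
       simple_graph V E \<and> card E \<ge> 1 \<and>
       graph_spectral_radius V E \<ge> (1 - \<delta>) * sqrt (real (card E)) \<longrightarrow>
         real (booksize E) \<ge> (1 / 3 - \<epsilon>) * sqrt (real (card E)) \<or>
         (\<exists>A B. A \<subseteq> V \<and> B \<subseteq> V \<and> A \<inter> B = {} \<and>
            real (card (sym_diff E (bipartite_edges A B))) \<le> \<epsilon> * real (card E)))"
  proof (rule exI[of _ \<delta>], rule conjI, goal_cases)
    case 1
    show ?case using \<epsilon> by (simp add: \<delta>_def)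
  next
    case 2
    show ?case
    proof (intro allI impI, elim conjE, goal_cases)
      case (1 V E)
      show ?case
      proof (cases "real (booksize E) < (1 / 3 - \<epsilon>) * sqrt (real (card E))")
        case True
        show ?thesis by (rule disjI2, rule rectangle[OF 1 True])
      next
        case False
        then show ?thesis by (intro disjI1 leI)
      qed
    qed
  qed
qed

end
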